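(* Let $R$ be a $3$-row graph with $s$ columns and with $R_C$ being eulerian. Let $\{p,q\}\subseteq\{1,2,\dots,s\}$ and suppose that every column $C_j$ of $R$ with $j\notin\{p,q\}$ contains two isolated vertices in $R$ (i.e. at least two of its three vertices are isolated in $R$). Then $R$ has an amiable coloring.
   Context: All graphs are finite and loopless; parallel edges are allowed. A graph (not necessarily connected) is eulerian if every vertex has even degree. $E_v$ is the set of edges incident with $v$; given an edge-coloring, $d_c(v,R)$ is the number of edges of color $c$ of $R$ incident with $v$. Colorings need not be proper; $3$-colorings use the colors $1,2,3$. A $3$-row graph $R$ with $s$ columns is a graph with vertices $v_{ij}$, $1\le i\le 3$, $1\le j\le s$, such that each column $C_j:=\{v_{1j},v_{2j},v_{3j}\}$ is an independent set of $R$. $R_C$ is the graph with vertex set $\{c_1,\dots,c_s\}$ obtained from $R$ by identifying, for each $j$, all vertices of $C_j$ to the single vertex $c_j$ (parallel edges are kept). An amiable coloring of a $3$-row graph $R$ is a $3$-vertex-coloring $f$ together with a $3$-edge-coloring $g$ such that for all $i\in\{1,2,3\}$ and $j\in\{1,\dots,s\}$: (i) $f(v)\ne f(w)$ for all $v\neq w$ in $C_j$; (ii) $f(v)\neq g(e)$ for every $v\in V(R)$ and every $e\in E_v$; (iii) $d_i(v_{1j},R)+d_i(v_{2j},R)+d_i(v_{3j},R)$ is even. *)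

theory Defs
  imports Main
begin

record ('v, 'e) multigraph =
  verts :: "'v set"
  edges :: "'e set"
  ends :: "'e \<Rightarrow> 'v set"

definition finite_loopless :: "('v, 'e) multigraph \<Rightarrow> bool" where
  "finite_loopless G \<longleftrightarrow> finite (verts G) \<and> finite (edges G) \<and>
     (\<forall>e \<in> edges G. ends G e \<subseteq> verts G \<and> card (ends G e) = 2)"

definition incident_edges :: "('v, 'e) multigraph \<Rightarrow> 'v \<Rightarrow> 'e set" where
  "incident_edges G v = {e \<in> edges G. v \<in> ends G e}"

(* For loopless graphs only: a loop would be counted once. *)
definition degree :: "('v, 'e) multigraph \<Rightarrow> 'v \<Rightarrow> nat" where
  "degree G v = card (incident_edges G v)"

definition isolated :: "('v, 'e) multigraph \<Rightarrow> 'v \<Rightarrow> bool" where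
  "isolated G v \<longleftrightarrow> v \<in> verts G \<and> incident_edges G v = {}"

definition eulerian :: "('v, 'e) multigraph \<Rightarrow> bool" where
  "eulerian G \<longleftrightarrow> (\<forall>v \<in> verts G. even (degree G v))"

definition color_degree ::
    "('v, 'e) multigraph \<Rightarrow> ('e \<Rightarrow> nat) \<Rightarrow> nat \<Rightarrow> 'v \<Rightarrow> nat" where
  "color_degree G g c v = card {e \<in> incident_edges G v. g e = c}"

definition independent :: "('v, 'e) multigraph \<Rightarrow> 'v set \<Rightarrow> bool" where
  "independent G S \<longleftrightarrow> S \<subseteq> verts G \<and> (\<forall>e \<in> edges G. \<not> ends G e \<subseteq> S)"

(* Identifies all vertices with the same image under h; the edge set is untouched,
   so parallel edges are kept. *)
definition identify :: "('v \<Rightarrow> 'w) \<Rightarrow> ('v, 'e) multigraph \<Rightarrow> ('w, 'e) multigraph" where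
  "identify h G = \<lparr>verts = h ` verts G, edges = edges G, ends = (\<lambda>e. h ` ends G e)\<rparr>"

(* The vertex in row i and column j is the pair (i, j). *)
definition column :: "nat \<Rightarrow> (nat \<times> nat) set" where
  "column j = {(1, j), (2, j), (3, j)}"

definition three_row_graph :: "nat \<Rightarrow> (nat \<times> nat, 'e) multigraph \<Rightarrow> bool" where
  "three_row_graph s R \<longleftrightarrow> finite_loopless R \<and> verts R = {1..3} \<times> {1..s} \<and>
     (\<forall>j \<in> {1..s}. independent R (column j))"

(* Column j becomes the single vertex j. *)
definition column_graph :: "(nat \<times> nat, 'e) multigraph \<Rightarrow> (nat, 'e) multigraph" where
  "column_graph R = identify snd R"

definition amiable_coloring ::
    "nat \<Rightarrow> (nat \<times> nat, 'e) multigraph \<Rightarrow> (nat \<times> nat \<Rightarrow> nat) \<Rightarrow> ('e \<Rightarrow> nat) \<Rightarrow> bool" where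
  "amiable_coloring s R f g \<longleftrightarrow>
     (\<forall>v \<in> verts R. f v \<in> {1, 2, 3}) \<and> (\<forall>e \<in> edges R. g e \<in> {1, 2, 3}) \<and>
     (\<forall>j \<in> {1..s}. \<forall>v \<in> column j. \<forall>w \<in> column j. v \<noteq> w \<longrightarrow> f v \<noteq> f w) \<and>
     (\<forall>v \<in> verts R. \<forall>e \<in> incident_edges R v. f v \<noteq> g e) \<and>
     (\<forall>i \<in> {1, 2, 3}. \<forall>j \<in> {1..s}.
        even (color_degree R g i (1, j) + color_degree R g i (2, j) + color_degree R g i (3, j)))"

end

theory Submission
  imports Defs
begin

text \<open>
  The three colors behave like the nonzero elements of the Klein four-group: once the vertices
  are colored, an edge with two differently colored ends must take the third color, while an edge
  with two ends of the same color \<open>a\<close> may still take either of the other two. Swapping those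
  two colors on such a monochromatic edge changes, at both ends, the parity of every color degree
  except that of \<open>a\<close>. Doing so on every edge of a monochromatic walk
  therefore moves a parity defect from one end of the walk to the other and leaves the rest of
  the graph alone (\<open>shift_defect\<close>).

  The vertices of the columns \<open>p\<close> and \<open>q\<close> serve as roots. Every other vertex has even degree.
  Divide the vertices that can reach a root into connected classes with one root each, and copy
  the color of a root to its whole class. Then every vertex with a root is tied to it by a
  monochromatic walk, so all defects can be pushed onto the roots, whatever colors the roots have
  (\<open>balanced_outside_roots\<close>). It remains to correct the sums over the two special
  columns. One of them is enough, as color degrees sum to an even number over the whole graph.

  Call \<open>(a, b)\<close> a crossing pair if some edge joins the class of the root \<open>a\<close> of column \<open>p\<close> to the
  class of the root \<open>b\<close> of column \<open>q\<close>. Giving \<open>a\<close> and \<open>b\<close> the same color makes a monochromatic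
  walk between the two columns. If there are two disjoint crossing pairs, they can be colored
  1 and 2, and shifts along the two walks correct every possible defect. If there is no crossing
  pair, no defect can be left on column \<open>p\<close>. In the remaining case fix one crossing pair
  \<open>(a, b)\<close>. Every other one shares \<open>a\<close> or \<open>b\<close> with it; color \<open>a\<close> and \<open>b\<close> with 1.
  Every edge between the two sides then has an end of color 1 and cannot have color 1 itself, so
  color 1 is even on column \<open>p\<close> automatically, and the one walk from \<open>a\<close> to \<open>b\<close> suffices for the other two colors. This is the
  content of \<open>two_special_sets\<close>. Isolated vertices carry no edge, so the colors in the remaining
  columns can finally be permuted to be distinct.
\<close>

section \<open>Colorings and parities\<close>

definition compatible :: "('v, 'e) multigraph \<Rightarrow> ('v \<Rightarrow> nat) \<Rightarrow> ('e \<Rightarrow> nat) \<Rightarrow> bool" where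
  "compatible G f g \<longleftrightarrow>
     (\<forall>v \<in> verts G. f v \<in> {1, 2, 3}) \<and> (\<forall>e \<in> edges G. g e \<in> {1, 2, 3} \<and> g e \<notin> f ` ends G e)"

definition balanced :: "('v, 'e) multigraph \<Rightarrow> ('e \<Rightarrow> nat) \<Rightarrow> 'v \<Rightarrow> bool" where
  "balanced G g v \<longleftrightarrow> (\<forall>c \<in> {1, 2, 3}. even (color_degree G g c v))"

definition monochromatic :: "('v, 'e) multigraph \<Rightarrow> ('v \<Rightarrow> nat) \<Rightarrow> ('v \<times> 'v) set" where
  "monochromatic G f = {(u, w). \<exists>e \<in> edges G. u \<in> ends G e \<and> w \<in> ends G e \<and> f u = f w}"

lemma finite_incident_edges: "finite_loopless G \<Longrightarrow> finite (incident_edges G v)"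
  by (simp add: finite_loopless_def incident_edges_def)

lemma sum_incidences:
  assumes "finite K" "finite S"
  shows "(\<Sum>v\<in>S. card {e \<in> K. v \<in> ends G e}) = (\<Sum>e\<in>K. card (ends G e \<inter> S))"
proof -
  have "(\<Sum>v\<in>S. card {e \<in> K. v \<in> ends G e}) = (\<Sum>v\<in>S. \<Sum>e\<in>K. if v \<in> ends G e then 1 else 0)"
    using assms by (simp add: sum.If_cases Int_def)
  also have "\<dots> = (\<Sum>e\<in>K. \<Sum>v\<in>S. if v \<in> ends G e then 1 else 0)"
    by (rule sum.swap)
  also have "\<dots> = (\<Sum>e\<in>K. card (ends G e \<inter> S))"
    using assms by (simp add: sum.If_cases Int_def conj_commute)
  finally show ?thesis .
qed

text \<open>
  Handshaking for one color class: an edge of color \<open>c\<close> counts twice or not at all. With \<open>S\<close> the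
  whole vertex set this says that defects cancel globally; with a smaller \<open>S\<close> it says that a
  defect in color \<open>c\<close> can be left on \<open>S\<close> only if an edge of color \<open>c\<close> crosses the boundary of \<open>S\<close>.
\<close>

lemma even_color_degree_sum:
  assumes "finite_loopless G" "finite S"
    and "\<And>e. e \<in> edges G \<Longrightarrow> g e = c \<Longrightarrow> ends G e \<inter> S \<noteq> {} \<Longrightarrow> ends G e \<subseteq> S"
  shows "even (\<Sum>v\<in>S. color_degree G g c v)"
proof -
  let ?K = "{e \<in> edges G. g e = c}"
  have "finite ?K"
    using assms(1) by (simp add: finite_loopless_def)
  have "(\<Sum>v\<in>S. color_degree G g c v) = (\<Sum>v\<in>S. card {e \<in> ?K. v \<in> ends G e})"
    unfolding color_degree_def incident_edges_def
    by (intro sum.cong refl arg_cong[where f = card]) auto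
  also have "\<dots> = (\<Sum>e\<in>?K. card (ends G e \<inter> S))"
    using \<open>finite ?K\<close> assms(2) by (rule sum_incidences)
  also have "even \<dots>"
  proof (rule dvd_sum)
    fix e assume e: "e \<in> ?K"
    then have "card (ends G e) = 2"
      using assms(1) by (simp add: finite_loopless_def)
    moreover have "ends G e \<inter> S = {} \<or> ends G e \<inter> S = ends G e"
      using assms(3)[of e] e by auto
    ultimately show "even (card (ends G e \<inter> S))"
      by auto
  qed
  finally show ?thesis .
qed

lemma degree_eq_color_degrees:
  assumes "finite_loopless G" "compatible G f g"
  shows "degree G v = color_degree G g 1 v + color_degree G g 2 v + color_degree G g 3 v"
proof -
  let ?E = "\<lambda>c. {e \<in> incident_edges G v. g e = c}"
  have fin: "finite (?E c)" for c
    using finite_incident_edges[OF assms(1)] by simp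
  have "incident_edges G v = ?E 1 \<union> ?E 2 \<union> ?E 3"
    using assms(2) unfolding compatible_def incident_edges_def by auto
  then have "degree G v = card (?E 1 \<union> ?E 2 \<union> ?E 3)"
    by (simp add: degree_def)
  also have "\<dots> = card (?E 1 \<union> ?E 2) + card (?E 3)"
    using fin by (intro card_Un_disjoint) auto
  also have "card (?E 1 \<union> ?E 2) = card (?E 1) + card (?E 2)"
    using fin by (intro card_Un_disjoint) auto
  finally show ?thesis
    by (simp add: color_degree_def)
qed

lemma color_degree_own_color:
  "compatible G f g \<Longrightarrow> color_degree G g (f v) v = 0"
  unfolding compatible_def color_degree_def incident_edges_def
  by (auto intro!: card_eq_0_iff[THEN iffD2])

text \<open>
  The color of \<open>v\<close> itself does not occur at \<open>v\<close>, and the other two color degrees have an even sum.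
  So a vertex of even degree has only one possible defect, and it is exactly the
  one that a shift along edges with ends colored \<open>f v\<close> repairs.
\<close>

lemma odd_color_degree_iff:
  assumes "finite_loopless G" "compatible G f g" "v \<in> verts G" "even (degree G v)"
    and c: "c \<in> {1, 2, 3}" and d: "d \<in> {1, 2, 3}" and odd: "odd (color_degree G g c v)"
  shows "odd (color_degree G g d v) \<longleftrightarrow> d \<noteq> f v"
proof -
  let ?n = "\<lambda>c. color_degree G g c v"
  have zero: "?n (f v) = 0"
    by (rule color_degree_own_color[OF assms(2)])
  have even: "even (?n 1 + ?n 2 + ?n 3)"
    using assms(4) degree_eq_color_degrees[OF assms(1,2)] by simp
  have "f v \<in> {1, 2, 3}"
    using assms(2,3) by (auto simp: compatible_def)
  then consider "f v = 1" | "f v = 2" | "f v = 3"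
    by blast
  then have "\<forall>d \<in> {1, 2, 3}. odd (?n d) \<longleftrightarrow> d \<noteq> f v"
  proof cases
    case 1
    then have "even (?n 1)" "odd (?n 2) = odd (?n 3)"
      using zero even by simp_all
    moreover from this have "odd (?n 2)"
      using c odd by fastforce
    ultimately show ?thesis
      using 1 by simp
  next
    case 2
    then have "even (?n 2)" "odd (?n 1) = odd (?n 3)"
      using zero even by simp_all
    moreover from this have "odd (?n 1)"
      using c odd by fastforce
    ultimately show ?thesis
      using 2 by simp
  next
    case 3
    then have "even (?n 3)" "odd (?n 1) = odd (?n 2)"
      using zero even by simp_all
    moreover from this have "odd (?n 1)"
      using c odd by fastforce
    ultimately show ?thesis
      using 3 by simp
  qed
  then show ?thesis
    using d by blast
qed

section \<open>Moving defects along monochromatic walks\<close>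

text \<open>The three colors add up to 6, so subtraction yields the third one.\<close>

lemma third_color:
  assumes "a \<in> {1, 2, 3 :: nat}" "b \<in> {1, 2, 3}" "a \<noteq> b"
  shows "6 - a - b \<in> {1, 2, 3} \<and> 6 - a - b \<noteq> a \<and> 6 - a - b \<noteq> b \<and>
    (\<forall>c \<in> {1, 2, 3}. c \<noteq> a \<longleftrightarrow> c = b \<or> c = 6 - a - b)"
proof -
  consider "a = 1" | "a = 2" | "a = 3" using assms(1) by blast
  then show ?thesis
  proof cases
    case 1
    then consider "b = 2" | "b = 3" using assms by blast
    then show ?thesis by cases (simp_all add: 1)
  next
    case 2
    then consider "b = 1" | "b = 3" using assms by blast
    then show ?thesis by cases (simp_all add: 2)
  next
    case 3
    then consider "b = 1" | "b = 2" using assms by blast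
    then show ?thesis by cases (simp_all add: 3)
  qed
qed

text \<open>
  Replacing the color of one monochromatic edge by the other admissible color. The degenerate
  case \<open>u = w\<close> is included, with nothing to do, so that walks need not be simple paths.
\<close>

lemma recolor_edge:
  assumes G: "finite_loopless G" and comp: "compatible G f g"
    and uw: "(u, w) \<in> monochromatic G f"
  shows "\<exists>g'. compatible G f g' \<and> (\<forall>x. \<forall>c \<in> {1, 2, 3}.
    odd (color_degree G g' c x) \<longleftrightarrow> (odd (color_degree G g c x) \<noteq> (c \<noteq> f u \<and> (x = u) \<noteq> (x = w))))"
proof (cases "u = w")
  case True
  then show ?thesis
    using comp by auto
next
  case False
  obtain e where e: "e \<in> edges G" "u \<in> ends G e" "w \<in> ends G e" and same: "f u = f w"
    using uw by (auto simp: monochromatic_def)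
  have "card (ends G e) = 2" and sub: "ends G e \<subseteq> verts G"
    using G e(1) by (auto simp: finite_loopless_def)
  then have ends: "ends G e = {u, w}"
    using e(2,3) False by (auto simp: card_2_iff)
  have fu: "f u \<in> {1, 2, 3}"
    using comp sub e(2) by (auto simp: compatible_def)
  have ge: "g e \<in> {1, 2, 3}" "g e \<noteq> f u"
    using comp e by (auto simp: compatible_def)
  define b where "b = 6 - f u - g e"
  have b: "b \<in> {1, 2, 3}" "b \<noteq> f u" "b \<noteq> g e"
    and third: "\<And>c. c \<in> {1, 2, 3} \<Longrightarrow> c \<noteq> f u \<longleftrightarrow> c = g e \<or> c = b"
    using third_color[OF fu ge(1) ge(2)[symmetric]] unfolding b_def by blast+
  define g' where "g' = g(e := b)"
  have "compatible G f g'"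
    using comp b ends same unfolding compatible_def g'_def by auto
  moreover have "odd (color_degree G g' c x) \<longleftrightarrow>
      (odd (color_degree G g c x) \<noteq> (c \<noteq> f u \<and> (x = u) \<noteq> (x = w)))" if c: "c \<in> {1, 2, 3}" for x c
  proof (cases "x \<in> {u, w}")
    case False
    then have "{a \<in> incident_edges G x. g' a = c} = {a \<in> incident_edges G x. g a = c}"
      using ends by (auto simp: incident_edges_def g'_def)
    then show ?thesis
      using False by (simp add: color_degree_def)
  next
    case True
    let ?A = "{a \<in> incident_edges G x - {e}. g a = c}"
    have fin: "finite ?A"
      using finite_incident_edges[OF G] by simp
    have "{a \<in> incident_edges G x. g a = c} = (if g e = c then insert e ?A else ?A)"
      using True ends e(1) by (auto simp: incident_edges_def)
    then have 1: "color_degree G g c x = (if g e = c then Suc (card ?A) else card ?A)"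
      using fin by (simp add: color_degree_def)
    have "{a \<in> incident_edges G x. g' a = c} = (if b = c then insert e ?A else ?A)"
      using True ends e(1) by (auto simp: incident_edges_def g'_def)
    then have 2: "color_degree G g' c x = (if b = c then Suc (card ?A) else card ?A)"
      using fin by (simp add: color_degree_def)
    show ?thesis
      using 1 2 third[OF c] b(3) True \<open>u \<noteq> w\<close> by auto
  qed
  ultimately show ?thesis
    by blast
qed

text \<open>
  Along a walk each interior vertex is hit twice, so the changes survive only at the two ends.
\<close>

lemma shift_defect:
  assumes G: "finite_loopless G" and comp: "compatible G f g"
    and uw: "(u, w) \<in> (monochromatic G f)\<^sup>*"
  shows "\<exists>g'. compatible G f g' \<and> (\<forall>x. \<forall>c \<in> {1, 2, 3}.
    odd (color_degree G g' c x) \<longleftrightarrow> (odd (color_degree G g c x) \<noteq> (c \<noteq> f u \<and> (x = u) \<noteq> (x = w))))"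
proof -
  have "f w = f u \<and> (\<exists>g'. compatible G f g' \<and> (\<forall>x. \<forall>c \<in> {1, 2, 3}.
    odd (color_degree G g' c x) \<longleftrightarrow> (odd (color_degree G g c x) \<noteq> (c \<noteq> f u \<and> (x = u) \<noteq> (x = w)))))"
    using uw
  proof (induction rule: rtrancl_induct)
    case base
    then show ?case
      using comp by auto
  next
    case (step v w)
    then obtain g1 where g1: "compatible G f g1" and fv: "f v = f u"
      and p1: "\<And>x c. c \<in> {1, 2, 3} \<Longrightarrow> odd (color_degree G g1 c x) \<longleftrightarrow>
        (odd (color_degree G g c x) \<noteq> (c \<noteq> f u \<and> (x = u) \<noteq> (x = v)))"
      by blast
    obtain g2 where g2: "compatible G f g2"
      and p2: "\<And>x c. c \<in> {1, 2, 3} \<Longrightarrow> odd (color_degree G g2 c x) \<longleftrightarrow>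
        (odd (color_degree G g1 c x) \<noteq> (c \<noteq> f v \<and> (x = v) \<noteq> (x = w)))"
      using recolor_edge[OF G g1 step.hyps(2)] by blast
    have "odd (color_degree G g2 c x) \<longleftrightarrow>
        (odd (color_degree G g c x) \<noteq> (c \<noteq> f u \<and> (x = u) \<noteq> (x = w)))" if "c \<in> {1, 2, 3}" for x c
      unfolding p2[OF that] p1[OF that] fv by blast
    moreover have "f w = f u"
      using step.hyps(2) fv by (auto simp: monochromatic_def)
    ultimately show ?case
      using g2 by blast
  qed
  then show ?thesis
    by blast
qed

text \<open>
  One vertex of \<open>T\<close> after the other sends its defect to a vertex of \<open>B\<close>. Vertices outside
  \<open>T\<close> and \<open>B\<close> are tracked as well, so that those with no connection to \<open>B\<close>, once balanced,
  stay so.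
\<close>

lemma clear_defects:
  assumes G: "finite_loopless G" and comp: "compatible G f g" and "finite T"
    and "\<And>v. v \<in> T \<Longrightarrow> v \<in> verts G - B \<and> even (degree G v) \<and> (\<exists>r \<in> B. (v, r) \<in> (monochromatic G f)\<^sup>*)"
  shows "\<exists>g'. compatible G f g' \<and> (\<forall>v \<in> T. balanced G g' v) \<and>
    (\<forall>v. v \<notin> T \<union> B \<longrightarrow> balanced G g' v = balanced G g v)"
  using assms(3,4)
proof (induction T rule: finite_induct)
  case empty
  then show ?case
    using comp by blast
next
  case (insert v T)
  have v: "v \<in> verts G" "v \<notin> B" "even (degree G v)"
    and "\<exists>r \<in> B. (v, r) \<in> (monochromatic G f)\<^sup>*"
    using insert.prems[of v] by auto
  then obtain r where r: "r \<in> B" "(v, r) \<in> (monochromatic G f)\<^sup>*"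
    by blast
  have TB: "T \<inter> B = {}"
    using insert.prems by blast
  obtain g1 where g1: "compatible G f g1" "\<forall>x \<in> T. balanced G g1 x"
      "\<forall>x. x \<notin> T \<union> B \<longrightarrow> balanced G g1 x = balanced G g x"
    using insert by (metis insertI2)
  show ?case
  proof (cases "balanced G g1 v")
    case True
    then show ?thesis
      using g1 by (intro exI[of _ g1]) simp
  next
    case False
    then obtain c0 where "c0 \<in> {1, 2, 3}" "odd (color_degree G g1 c0 v)"
      unfolding balanced_def by blast
    note odd1 = odd_color_degree_iff[OF G g1(1) v(1,3) this(1) _ this(2)]
    obtain g2 where g2: "compatible G f g2"
      and p2: "\<And>x c. c \<in> {1, 2, 3} \<Longrightarrow> odd (color_degree G g2 c x) \<longleftrightarrow>
        (odd (color_degree G g1 c x) \<noteq> (c \<noteq> f v \<and> (x = v) \<noteq> (x = r)))"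
      using shift_defect[OF G g1(1) r(2)] by blast
    have "v \<noteq> r"
      using v(2) r(1) by blast
    then have "balanced G g2 v"
      unfolding balanced_def by (intro ballI) (metis p2 odd1)
    moreover have other: "balanced G g2 x = balanced G g1 x" if "x \<noteq> v" "x \<notin> B" for x
    proof -
      have "x \<noteq> r"
        using that(2) r(1) by blast
      then show ?thesis
        unfolding balanced_def using that(1) by (intro ball_cong refl) (metis p2)
    qed
    moreover have "balanced G g2 x" if "x \<in> T" for x
    proof -
      have "x \<noteq> v" "x \<notin> B"
        using that TB insert.hyps(2) by blast+
      then show ?thesis
        using other g1(2) that by simp
    qed
    moreover have "balanced G g2 x = balanced G g x" if "x \<notin> insert v T \<union> B" for x
      using that other[of x] g1(3) by simp
    ultimately show ?thesis
      using g2 by (intro exI[of _ g2]) simp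
  qed
qed

section \<open>Assigning roots\<close>

text \<open>
  A rooting \<open>\<rho>\<close> partitions the part of the graph that can reach \<open>B\<close> into classes, one for each
  element of \<open>B\<close>, such that a vertex is connected to its root inside its own class. The value
  \<open>None\<close> marks the vertices in components that do not meet \<open>B\<close>. Excluding \<open>None\<close> in \<open>joined\<close>
  makes the relation grow when \<open>\<rho>\<close> is extended.
\<close>

definition joined :: "('v, 'e) multigraph \<Rightarrow> ('v \<Rightarrow> 'v option) \<Rightarrow> ('v \<times> 'v) set" where
  "joined G \<rho> = {(u, w). \<exists>e \<in> edges G. u \<in> ends G e \<and> w \<in> ends G e \<and> \<rho> u = \<rho> w \<and> \<rho> u \<noteq> None}"

definition partial_rooting :: "('v, 'e) multigraph \<Rightarrow> 'v set \<Rightarrow> ('v \<Rightarrow> 'v option) \<Rightarrow> bool" where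
  "partial_rooting G B \<rho> \<longleftrightarrow> dom \<rho> \<subseteq> verts G \<and> (\<forall>v \<in> B. \<rho> v = Some v) \<and>
     (\<forall>v r. \<rho> v = Some r \<longrightarrow> r \<in> B \<and> (v, r) \<in> (joined G \<rho>)\<^sup>*)"

definition rooting :: "('v, 'e) multigraph \<Rightarrow> 'v set \<Rightarrow> ('v \<Rightarrow> 'v option) \<Rightarrow> bool" where
  "rooting G B \<rho> \<longleftrightarrow> partial_rooting G B \<rho> \<and>
     (\<forall>e \<in> edges G. \<forall>u \<in> ends G e. \<forall>w \<in> ends G e. \<rho> u = None \<longrightarrow> \<rho> w = None)"

text \<open>
  A partial rooting with largest domain works: an unrooted vertex adjacent to a rooted one could
  adopt the root of its neighbor.
\<close>

lemma rooting_exists: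
  assumes G: "finite_loopless G" and "B \<subseteq> verts G"
  shows "\<exists>\<rho>. rooting G B \<rho>"
proof -
  have fin: "finite (verts G)"
    using G by (simp add: finite_loopless_def)
  have start: "partial_rooting G B (\<lambda>v. if v \<in> B then Some v else None)"
    using assms(2) by (auto simp: partial_rooting_def dom_def split: if_splits)
  have bound: "\<forall>\<rho>. partial_rooting G B \<rho> \<longrightarrow> card (dom \<rho>) < Suc (card (verts G))"
    using fin by (auto simp: partial_rooting_def card_mono less_Suc_eq_le)
  obtain \<rho> where \<rho>: "partial_rooting G B \<rho>"
    and max: "\<And>\<rho>'. partial_rooting G B \<rho>' \<Longrightarrow> card (dom \<rho>') \<le> card (dom \<rho>)"
    using ex_has_greatest_nat[of "partial_rooting G B", OF start bound] by (elim exE conjE) blast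
  have "\<rho> w = None" if e: "e \<in> edges G" "u \<in> ends G e" "w \<in> ends G e" "\<rho> u = None" for e u w
  proof (rule ccontr)
    assume "\<rho> w \<noteq> None"
    then obtain r where r: "\<rho> w = Some r"
      by auto
    let ?\<rho>' = "\<rho>(u \<mapsto> r)"
    have "joined G \<rho> \<subseteq> joined G ?\<rho>'"
      using e(4) by (fastforce simp: joined_def)
    then have mono: "(joined G \<rho>)\<^sup>* \<subseteq> (joined G ?\<rho>')\<^sup>*"
      by (rule rtrancl_mono)
    have "(u, w) \<in> joined G ?\<rho>'"
      using e r by (auto simp: joined_def)
    moreover have "(w, r) \<in> (joined G ?\<rho>')\<^sup>*" "r \<in> B"
      using \<rho> r mono by (auto simp: partial_rooting_def)
    ultimately have "(u, r) \<in> (joined G ?\<rho>')\<^sup>*"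
      by (meson converse_rtrancl_into_rtrancl)
    moreover have "u \<in> verts G"
      using G e(1,2) by (auto simp: finite_loopless_def)
    moreover have "u \<notin> B"
      using \<rho> e(4) by (auto simp: partial_rooting_def)
    ultimately have "partial_rooting G B ?\<rho>'"
      using \<rho> \<open>r \<in> B\<close> mono unfolding partial_rooting_def by auto
    then have "card (dom ?\<rho>') \<le> card (dom \<rho>)"
      by (rule max)
    moreover have "finite (dom \<rho>)" "u \<notin> dom \<rho>"
      using \<rho> fin e(4) by (auto simp: partial_rooting_def intro: finite_subset)
    ultimately show False
      by simp
  qed
  then show ?thesis
    using \<rho> unfolding rooting_def by blast
qed

text \<open>The vertices without a root share one color, so that all edges at them are monochromatic.\<close>

definition color_by_root :: "('v \<Rightarrow> nat) \<Rightarrow> ('v \<Rightarrow> 'v option) \<Rightarrow> 'v \<Rightarrow> nat" where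
  "color_by_root f \<rho> v = (case \<rho> v of None \<Rightarrow> 1 | Some r \<Rightarrow> f r)"

lemma joined_subset_monochromatic: "joined G \<rho> \<subseteq> monochromatic G (color_by_root f \<rho>)"
  by (auto simp: joined_def monochromatic_def color_by_root_def)

lemma sym_monochromatic_rtrancl:
  "(u, w) \<in> (monochromatic G f)\<^sup>* \<Longrightarrow> (w, u) \<in> (monochromatic G f)\<^sup>*"
proof -
  have "sym (monochromatic G f)"
    by (auto simp: sym_def monochromatic_def)
  then show "(u, w) \<in> (monochromatic G f)\<^sup>* \<Longrightarrow> (w, u) \<in> (monochromatic G f)\<^sup>*"
    by (meson sym_rtrancl symD)
qed

lemma color_by_root_connected:
  assumes "rooting G B \<rho>" "\<rho> v = Some r"
  shows "(v, r) \<in> (monochromatic G (color_by_root f \<rho>))\<^sup>*"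
proof -
  have "(v, r) \<in> (joined G \<rho>)\<^sup>*"
    using assms by (auto simp: rooting_def partial_rooting_def)
  then show ?thesis
    using rtrancl_mono[OF joined_subset_monochromatic[of G \<rho> f]] by blast
qed

text \<open>
  The colors of the roots are arbitrary here; they are chosen later according to how the classes
  meet. Rooted vertices send their defects to their roots. Unrooted vertices need no repair: every
  edge at such a vertex has both ends of color 1 and receives color 2 from the start.
\<close>

lemma balanced_outside_roots:
  assumes G: "finite_loopless G" and \<rho>: "rooting G B \<rho>"
    and f: "f ` B \<subseteq> {1, 2, 3}"
    and deg: "\<And>v. v \<in> verts G - B \<Longrightarrow> even (degree G v)"
  shows "\<exists>g. compatible G (color_by_root f \<rho>) g \<and>
    (\<forall>v \<in> verts G - B. balanced G g v)"
proof -
  let ?f = "color_by_root f \<rho>"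
  have f123: "?f v \<in> {1, 2, 3}" for v
  proof (cases "\<rho> v")
    case (Some r)
    then have "r \<in> B"
      using \<rho> by (auto simp: rooting_def partial_rooting_def)
    then show ?thesis
      using f Some by (auto simp: color_by_root_def)
  qed (simp add: color_by_root_def)
  have "\<exists>c. c \<in> {1, 2, 3} \<and> c \<notin> ?f ` ends G e \<and> (?f ` ends G e = {1} \<longrightarrow> c = 2)"
    if e: "e \<in> edges G" for e
  proof -
    obtain u w where "ends G e = {u, w}"
      using G e by (auto simp: finite_loopless_def card_2_iff)
    then show ?thesis
      using f123[of u] f123[of w] by auto
  qed
  then obtain g where g: "\<And>e. e \<in> edges G \<Longrightarrow> g e \<in> {1, 2, 3} \<and> g e \<notin> ?f ` ends G e \<and>
      (?f ` ends G e = {1} \<longrightarrow> g e = 2)"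
    by metis
  then have comp: "compatible G ?f g"
    using f123 by (auto simp: compatible_def)
  let ?T = "{v \<in> verts G - B. \<rho> v \<noteq> None}"
  have "finite ?T"
    using G by (simp add: finite_loopless_def)
  moreover have "\<exists>r \<in> B. (v, r) \<in> (monochromatic G ?f)\<^sup>*" if v: "v \<in> ?T" for v
  proof -
    obtain r where r: "\<rho> v = Some r"
      using v by auto
    then have "r \<in> B"
      using \<rho> by (auto simp: rooting_def partial_rooting_def)
    then show ?thesis
      using color_by_root_connected[OF \<rho> r] by blast
  qed
  ultimately obtain g' where g': "compatible G ?f g'"
    and T: "\<forall>v \<in> ?T. balanced G g' v"
    and N: "\<forall>v. v \<notin> ?T \<union> B \<longrightarrow> balanced G g' v = balanced G g v"
    using clear_defects[OF G comp, of ?T B] deg by (metis (lifting) mem_Collect_eq)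
  have "balanced G g v" if v: "v \<in> verts G - B" "\<rho> v = None" for v
  proof -
    have "g e = 2" if e: "e \<in> incident_edges G v" for e
    proof -
      have e': "e \<in> edges G" "v \<in> ends G e"
        using e by (auto simp: incident_edges_def)
      then have "\<forall>w \<in> ends G e. \<rho> w = None"
        using \<rho> v(2) unfolding rooting_def by blast
      then have "?f ` ends G e = {1}"
        using e'(2) by (auto simp: color_by_root_def)
      then show ?thesis
        using g e'(1) by blast
    qed
    then have "{e \<in> incident_edges G v. g e = c} = (if c = 2 then incident_edges G v else {})" for c
      by auto
    then show ?thesis
      using deg[OF v(1)] by (simp add: balanced_def color_degree_def degree_def)
  qed
  then have "\<forall>v \<in> verts G - B. balanced G g' v"
    using T N by blast
  then show ?thesis
    using g' by blast
qed

section \<open>Two special sets of vertices\<close>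

lemma injective_coloring:
  assumes "finite A" "card A \<le> 3" "a \<in> A" "b \<in> A" "a \<noteq> b"
  shows "\<exists>f. inj_on f A \<and> f ` A \<subseteq> {1, 2, 3 :: nat} \<and> f a = 1 \<and> f b = 2"
proof -
  let ?f = "\<lambda>x. if x = a then 1 else if x = b then 2 else 3 :: nat"
  have "card (A - {a, b}) \<le> 1"
    using assms by (simp add: card_Diff_subset)
  then have uniq: "x = y" if "x \<in> A - {a, b}" "y \<in> A - {a, b}" for x y
    using assms(1) that by (metis card_le_Suc0_iff_eq One_nat_def finite_Diff)
  have "inj_on ?f A"
  proof (rule inj_onI)
    fix x y assume "x \<in> A" "y \<in> A" "?f x = ?f y"
    then show "x = y"
      using uniq[of x y] by (simp split: if_splits)
  qed
  then show ?thesis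
    using assms(5) by (intro exI[of _ ?f]) (simp add: image_subset_iff)
qed

lemma injective_coloring_one:
  assumes "finite A" "card A \<le> 3"
  shows "\<exists>f. inj_on f A \<and> f ` A \<subseteq> {1, 2, 3 :: nat} \<and> (a \<in> A \<longrightarrow> f a = 1)"
proof (cases "\<exists>x y. x \<in> A \<and> y \<in> A \<and> x \<noteq> y")
  case False
  then show ?thesis
    by (intro exI[of _ "\<lambda>_. 1"]) (auto simp: inj_on_def)
next
  case True
  show ?thesis
  proof (cases "a \<in> A")
    case True
    then obtain b where "b \<in> A" "a \<noteq> b"
      using \<open>\<exists>x y. _\<close> by metis
    then show ?thesis
      using injective_coloring[OF assms True] by blast
  next
    case False
    then show ?thesis
      using injective_coloring[OF assms] \<open>\<exists>x y. _\<close> by metis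
  qed
qed

text \<open>
  The combinatorial core, stated without columns: \<open>P\<close> and \<open>Q\<close> stand for the two special ones,
  and allowing them to be smaller covers the case of a single special column by an
  empty \<open>Q\<close>.
\<close>

lemma two_special_sets:
  assumes G: "finite_loopless G" and PQ: "P \<subseteq> verts G" "Q \<subseteq> verts G" "P \<inter> Q = {}"
    and card: "card P \<le> 3" "card Q \<le> 3"
    and deg: "\<And>v. v \<in> verts G - (P \<union> Q) \<Longrightarrow> even (degree G v)"
    and degP: "even (\<Sum>v\<in>P. degree G v)"
  shows "\<exists>f g. compatible G f g \<and> inj_on f P \<and> inj_on f Q \<and>
    (\<forall>v \<in> verts G - (P \<union> Q). balanced G g v) \<and>
    (\<forall>c \<in> {1, 2, 3}. even (\<Sum>v\<in>P. color_degree G g c v) \<and> even (\<Sum>v\<in>Q. color_degree G g c v))"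
proof -
  let ?B = "P \<union> Q"
  let ?cd = "color_degree G"
  have fin: "finite (verts G)" and finP: "finite P" and finQ: "finite Q"
    using G PQ by (auto simp: finite_loopless_def intro: finite_subset)
  obtain \<rho> where \<rho>: "rooting G ?B \<rho>"
    using rooting_exists[OF G, of ?B] PQ by auto
  have root: "\<rho> v = Some v" if "v \<in> ?B" for v
    using \<rho> that by (auto simp: rooting_def partial_rooting_def)
  have rootB: "r \<in> ?B" "v \<in> verts G" if "\<rho> v = Some r" for v r
    using \<rho> that by (auto simp: rooting_def partial_rooting_def)
  \<comment> \<open>The crossing pairs, and the colorings that have defects at the roots only.\<close>
  define X where "X = {(a, b). a \<in> P \<and> b \<in> Q \<and>
    (\<exists>e \<in> edges G. \<exists>u \<in> ends G e. \<exists>w \<in> ends G e. \<rho> u = Some a \<and> \<rho> w = Some b)}"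
  define good where "good = (\<lambda>f g. compatible G (color_by_root f \<rho>) g \<and>
    (\<forall>v \<in> verts G - ?B. balanced G g v))"

  \<comment> \<open>A crossing pair with equal colors lets a defect of \<open>P\<close> escape to \<open>Q\<close>.\<close>
  have shift: "\<exists>g'. good f g' \<and> (\<forall>c \<in> {1, 2, 3}.
      odd (\<Sum>v\<in>P. ?cd g' c v) \<longleftrightarrow> (odd (\<Sum>v\<in>P. ?cd g c v) \<noteq> (c \<noteq> f a)))"
    if g: "good f g" and ab: "(a, b) \<in> X" "f a = f b" for f g a b
  proof -
    let ?f = "color_by_root f \<rho>"
    obtain e u w where e: "a \<in> P" "b \<in> Q" "e \<in> edges G" "u \<in> ends G e" "w \<in> ends G e"
      "\<rho> u = Some a" "\<rho> w = Some b"
      using ab(1) by (auto simp: X_def)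
    have "(u, w) \<in> monochromatic G ?f"
      using e ab(2) by (auto simp: monochromatic_def color_by_root_def)
    moreover have "(a, u) \<in> (monochromatic G ?f)\<^sup>*" "(w, b) \<in> (monochromatic G ?f)\<^sup>*"
      using color_by_root_connected[OF \<rho>] e(6,7) sym_monochromatic_rtrancl by metis+
    ultimately have path: "(a, b) \<in> (monochromatic G ?f)\<^sup>*"
      by (meson rtrancl.rtrancl_into_rtrancl rtrancl_trans)
    have fa: "?f a = f a"
      using root e(1) by (simp add: color_by_root_def)
    obtain g' where g': "compatible G ?f g'"
      and par: "\<And>x c. c \<in> {1, 2, 3} \<Longrightarrow> odd (?cd g' c x) \<longleftrightarrow>
        (odd (?cd g c x) \<noteq> (c \<noteq> f a \<and> (x = a) \<noteq> (x = b)))"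
      using shift_defect[OF G _ path, of g] g unfolding good_def fa by blast
    have "balanced G g' v" if v: "v \<in> verts G - ?B" for v
    proof -
      have "v \<noteq> a" "v \<noteq> b"
        using v e(1,2) by auto
      then have "balanced G g' v = balanced G g v"
        unfolding balanced_def by (intro ball_cong refl) (metis par)
      then show ?thesis
        using g v by (simp add: good_def)
    qed
    then have "good f g'"
      using g' by (simp add: good_def)
    moreover have "odd (\<Sum>v\<in>P. ?cd g' c v) \<longleftrightarrow> (odd (\<Sum>v\<in>P. ?cd g c v) \<noteq> (c \<noteq> f a))"
      if c: "c \<in> {1, 2, 3}" for c
    proof -
      have "even (\<Sum>v\<in>P - {a}. ?cd g' c v) \<longleftrightarrow> even (\<Sum>v\<in>P - {a}. ?cd g c v)"
      proof -
        have "{v \<in> P - {a}. odd (?cd g' c v)} = {v \<in> P - {a}. odd (?cd g c v)}"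
          using par[OF c] e(2) PQ(3) by auto
        then show ?thesis
          using finP by (simp add: even_sum_iff)
      qed
      then show ?thesis
        using par[OF c, of a] e(1,2) PQ(3) finP by (auto simp: sum.remove[of P a])
    qed
    ultimately show ?thesis
      by blast
  qed

  \<comment> \<open>The degree sum over \<open>P\<close> is even, so the parities of two colors determine the third.\<close>
  have all_even: "\<forall>c \<in> {1, 2, 3}. even (\<Sum>v\<in>P. ?cd g c v)"
    if "good f g" "even (\<Sum>v\<in>P. ?cd g 1 v)" "even (\<Sum>v\<in>P. ?cd g 2 v)" for f g
  proof -
    have "(\<Sum>v\<in>P. degree G v) = (\<Sum>v\<in>P. ?cd g 1 v + ?cd g 2 v + ?cd g 3 v)"
      using degree_eq_color_degrees[OF G] that(1) unfolding good_def by (intro sum.cong) blast+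
    then have "even (\<Sum>v\<in>P. ?cd g 3 v)"
      using degP that(2,3) by (simp add: sum.distrib)
    then show ?thesis
      using that(2,3) by simp
  qed

  \<comment> \<open>If each crossing pair has an end colored \<open>c\<close>, no edge of color \<open>c\<close> leaves the union of the
     classes rooted in \<open>P\<close>; since its vertices outside \<open>P\<close> are balanced, \<open>P\<close> is even in \<open>c\<close>.\<close>
  have cut: "even (\<Sum>v\<in>P. ?cd g c v)"
    if g: "good f g" and c: "c \<in> {1, 2, 3}"
      and avoid: "\<And>a b. (a, b) \<in> X \<Longrightarrow> f a = c \<or> f b = c" for f g c
  proof -
    let ?S = "{v. \<exists>r \<in> P. \<rho> v = Some r}"
    have S: "?S \<subseteq> verts G"
      using rootB by blast
    then have finS: "finite ?S"
      using fin finite_subset by blast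
    have "even (\<Sum>v\<in>?S. ?cd g c v)"
    proof (rule even_color_degree_sum[OF G finS], rule ccontr)
      fix e assume e: "e \<in> edges G" "g e = c" "ends G e \<inter> ?S \<noteq> {}" "\<not> ends G e \<subseteq> ?S"
      obtain u a where u: "u \<in> ends G e" "a \<in> P" "\<rho> u = Some a"
        using e(3) by blast
      obtain w where w: "w \<in> ends G e" "w \<notin> ?S"
        using e(4) by blast
      have "\<rho> w \<noteq> None"
        using \<rho> e(1) u w(1) unfolding rooting_def by (metis option.distinct(1))
      then obtain b where b: "\<rho> w = Some b"
        by auto
      then have "b \<in> Q"
        using rootB(1)[OF b] w(2) by blast
      then have "(a, b) \<in> X"
        using e(1) u w(1) b by (auto simp: X_def)
      then have "f a = c \<or> f b = c"
        by (rule avoid)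
      then have "c \<in> color_by_root f \<rho> ` ends G e"
        using u w(1) b by (force simp: color_by_root_def)
      then show False
        using g e(1,2) by (auto simp: good_def compatible_def)
    qed
    moreover have "P \<subseteq> ?S"
      using root by blast
    then have "(\<Sum>v\<in>?S. ?cd g c v) = (\<Sum>v\<in>?S - P. ?cd g c v) + (\<Sum>v\<in>P. ?cd g c v)"
      using finS by (rule sum.subset_diff)
    moreover have "even (\<Sum>v\<in>?S - P. ?cd g c v)"
    proof (rule dvd_sum)
      fix v assume v: "v \<in> ?S - P"
      then have "v \<notin> Q"
        using root[of v] PQ(3) by auto
      then show "even (?cd g c v)"
        using v S g c unfolding good_def balanced_def by blast
    qed
    ultimately show ?thesis
      by simp
  qed

  have start: "\<exists>g. good f g" if "f ` ?B \<subseteq> {1, 2, 3}" for f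
    using balanced_outside_roots[OF G \<rho> that] deg by (auto simp: good_def)

  \<comment> \<open>Correcting \<open>P\<close> corrects \<open>Q\<close>, because the sum over all vertices is even.\<close>
  have finish: ?thesis
    if f: "inj_on f P" "inj_on f Q" and g: "good f g"
      and P: "\<forall>c \<in> {1, 2, 3}. even (\<Sum>v\<in>P. ?cd g c v)" for f g
  proof (intro exI conjI ballI)
    have eq: "color_by_root f \<rho> v = f v" if "v \<in> ?B" for v
      using root[OF that] by (simp add: color_by_root_def)
    show "compatible G (color_by_root f \<rho>) g"
      using g by (simp add: good_def)
    show "inj_on (color_by_root f \<rho>) P" "inj_on (color_by_root f \<rho>) Q"
      using f eq by (auto simp: inj_on_def)
    show "balanced G g v" if "v \<in> verts G - ?B" for v
      using g that by (simp add: good_def)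
    fix c assume c: "c \<in> {1, 2, 3::nat}"
    have rest: "even (?cd g c v)" if "v \<in> verts G - ?B" for v
      using g c that unfolding good_def balanced_def by blast
    show "even (\<Sum>v\<in>P. ?cd g c v)"
      by (rule bspec[OF P c])
    have "even (\<Sum>v\<in>verts G. ?cd g c v)"
      using G fin by (intro even_color_degree_sum) (auto simp: finite_loopless_def)
    moreover have "(\<Sum>v\<in>verts G. ?cd g c v) =
        (\<Sum>v\<in>verts G - ?B. ?cd g c v) + ((\<Sum>v\<in>P. ?cd g c v) + (\<Sum>v\<in>Q. ?cd g c v))"
      using sum.subset_diff[of ?B "verts G" "?cd g c"] sum.union_disjoint[OF finP finQ PQ(3), of "?cd g c"]
        PQ fin by simp
    moreover have "even (\<Sum>v\<in>verts G - ?B. ?cd g c v)"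
      by (rule dvd_sum) (rule rest)
    ultimately show "even (\<Sum>v\<in>Q. ?cd g c v)"
      using bspec[OF P c] by simp
  qed

  have glue: "\<exists>f. inj_on f P \<and> inj_on f Q \<and> f ` ?B \<subseteq> {1, 2, 3} \<and> (\<forall>v \<in> P. f v = fP v) \<and> (\<forall>v \<in> Q. f v = fQ v)"
    if "inj_on fP P" "fP ` P \<subseteq> {1, 2, 3}" "inj_on fQ Q" "fQ ` Q \<subseteq> {1, 2, 3}" for fP fQ :: "_ \<Rightarrow> nat"
  proof -
    let ?f = "\<lambda>v. if v \<in> P then fP v else fQ v"
    have eq: "\<forall>v \<in> P. ?f v = fP v" "\<forall>v \<in> Q. ?f v = fQ v"
      using PQ(3) by auto
    have "inj_on ?f P" "inj_on ?f Q"
      using that(1,3) eq inj_on_cong[of P ?f fP] inj_on_cong[of Q ?f fQ] by blast+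
    moreover have "?f ` ?B \<subseteq> {1, 2, 3}"
    proof (rule image_subsetI)
      fix v assume "v \<in> ?B"
      show "?f v \<in> {1, 2, 3}"
      proof (cases "v \<in> P")
        case True
        then have "fP v \<in> {1, 2, 3}"
          using that(2) by blast
        then show ?thesis
          using True by simp
      next
        case False
        then have "fQ v \<in> {1, 2, 3}"
          using \<open>v \<in> ?B\<close> that(4) by blast
        then show ?thesis
          using False by simp
      qed
    qed
    ultimately show ?thesis
      using eq by blast
  qed

  \<comment> \<open>All crossing pairs meet \<open>(a0, b0)\<close>: color 1 is even by the cut argument, also after a shift,
     and one shift along color 1 flips colors 2 and 3 together.\<close>
  have star: ?thesis
    if x: "a0 \<in> P" "b0 \<in> Q" "(a0, b0) \<in> X" "\<And>a b. (a, b) \<in> X \<Longrightarrow> a = a0 \<or> b = b0" for a0 b0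
  proof -
    obtain fP where fP: "inj_on fP P" "fP ` P \<subseteq> {1, 2, 3}" "fP a0 = (1::nat)"
      using injective_coloring_one[OF finP card(1), of a0] x(1) by blast
    obtain fQ where fQ: "inj_on fQ Q" "fQ ` Q \<subseteq> {1, 2, 3}" "fQ b0 = (1::nat)"
      using injective_coloring_one[OF finQ card(2), of b0] x(2) by blast
    obtain f where f: "inj_on f P" "inj_on f Q" "f ` ?B \<subseteq> {1, 2, 3}"
        and ext: "\<forall>v \<in> P. f v = fP v" "\<forall>v \<in> Q. f v = fQ v"
      using glue[OF fP(1,2) fQ(1,2)] by blast
    have one_a0: "f a0 = 1" and one_b0: "f b0 = 1"
      using ext fP(3) fQ(3) x(1,2) by simp_all
    then have eq: "f a0 = f b0"
      by simp
    obtain g where g: "good f g"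
      using start[OF f(3)] by blast
    have one: "even (\<Sum>v\<in>P. ?cd g' 1 v)" if "good f g'" for g'
      using cut[OF that, of 1] x(4) one_a0 one_b0 by blast
    show ?thesis
    proof (cases "even (\<Sum>v\<in>P. ?cd g 2 v)")
      case True
      show ?thesis
        by (intro finish[OF f(1,2) g] all_even[OF g one[OF g] True])
    next
      case False
      obtain g' where g': "good f g'"
        "\<forall>c \<in> {1, 2, 3}. odd (\<Sum>v\<in>P. ?cd g' c v) \<longleftrightarrow> (odd (\<Sum>v\<in>P. ?cd g c v) \<noteq> (c \<noteq> f a0))"
        using shift[OF g x(3) eq] by blast
      have "even (\<Sum>v\<in>P. ?cd g' 2 v)"
        using g'(2) False one_a0 by simp
      then show ?thesis
        by (intro finish[OF f(1,2) g'(1)] all_even[OF g'(1) one[OF g'(1)]])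
    qed
  qed

  show ?thesis
  proof (cases "X = {}")
    case True
    obtain fP where fP: "inj_on fP P" "fP ` P \<subseteq> {1, 2, 3 :: nat}"
      using injective_coloring_one[OF finP card(1)] by blast
    obtain fQ where fQ: "inj_on fQ Q" "fQ ` Q \<subseteq> {1, 2, 3 :: nat}"
      using injective_coloring_one[OF finQ card(2)] by blast
    obtain f where f: "inj_on f P" "inj_on f Q" "f ` ?B \<subseteq> {1, 2, 3 :: nat}"
      using glue[OF fP fQ] by blast
    obtain g where g: "good f g"
      using start[OF f(3)] by blast
    show ?thesis
      by (intro finish[OF f(1,2) g] ballI cut[OF g]) (use True in auto)
  next
    case False
    then obtain a0 b0 where ab: "(a0, b0) \<in> X"
      by auto
    then have ab': "a0 \<in> P" "b0 \<in> Q"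
      by (auto simp: X_def)
    show ?thesis
    proof (cases "\<exists>c d. (c, d) \<in> X \<and> c \<noteq> a0 \<and> d \<noteq> b0")
      case True
      then obtain c d where cd: "(c, d) \<in> X" "c \<noteq> a0" "d \<noteq> b0"
        by blast
      then have in_PQ: "c \<in> P" "d \<in> Q"
        by (auto simp: X_def)
      obtain fP where fP: "inj_on fP P" "fP ` P \<subseteq> {1, 2, 3}" "fP a0 = (1::nat)" "fP c = 2"
        using injective_coloring[OF finP card(1) ab'(1) in_PQ(1) cd(2)[symmetric]] by blast
      obtain fQ where fQ: "inj_on fQ Q" "fQ ` Q \<subseteq> {1, 2, 3}" "fQ b0 = (1::nat)" "fQ d = 2"
        using injective_coloring[OF finQ card(2) ab'(2) in_PQ(2) cd(3)[symmetric]] by blast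
      obtain f where f: "inj_on f P" "inj_on f Q" "f ` ?B \<subseteq> {1, 2, 3}"
          and ext: "\<forall>v \<in> P. f v = fP v" "\<forall>v \<in> Q. f v = fQ v"
        using glue[OF fP(1,2) fQ(1,2)] by blast
      have vals: "f a0 = 1" "f b0 = 1" "f c = 2" "f d = 2"
        using ext fP(3,4) fQ(3,4) in_PQ ab' by simp_all
      obtain g where g: "good f g"
        using start[OF f(3)] by blast
      \<comment> \<open>The shift along color 1 repairs color 2; the one along color 2 then repairs color 1
         without touching color 2 again.\<close>
      obtain g1 where g1: "good f g1" "even (\<Sum>v\<in>P. ?cd g1 2 v)"
      proof (cases "even (\<Sum>v\<in>P. ?cd g 2 v)")
        case True
        show ?thesis
          by (rule that[OF g True])
      next
        case False
        obtain g' where "good f g'"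
          "\<forall>c \<in> {1, 2, 3}. odd (\<Sum>v\<in>P. ?cd g' c v) \<longleftrightarrow> (odd (\<Sum>v\<in>P. ?cd g c v) \<noteq> (c \<noteq> f a0))"
          using shift[OF g ab] vals by metis
        then show ?thesis
          using that False vals(1) by simp
      qed
      obtain g2 where g2: "good f g2" "even (\<Sum>v\<in>P. ?cd g2 1 v)" "even (\<Sum>v\<in>P. ?cd g2 2 v)"
      proof (cases "even (\<Sum>v\<in>P. ?cd g1 1 v)")
        case True
        show ?thesis
          by (rule that[OF g1(1) True g1(2)])
      next
        case False
        obtain g' where "good f g'"
          "\<forall>c' \<in> {1, 2, 3}. odd (\<Sum>v\<in>P. ?cd g' c' v) \<longleftrightarrow> (odd (\<Sum>v\<in>P. ?cd g1 c' v) \<noteq> (c' \<noteq> f c))"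
          using shift[OF g1(1) cd(1)] vals by metis
        then show ?thesis
          using that False g1(2) vals(3) by simp
      qed
      show ?thesis
        by (intro finish[OF f(1,2) g2(1)] all_even[OF g2])
    next
      case False
      then show ?thesis
        using star[OF ab' ab] by blast
    qed
  qed
qed

section \<open>Three-row graphs\<close>

lemma bij_betw_prescribed_value:
  assumes "finite A" "finite B" "card A = card B" "a \<in> A" "b \<in> B"
  shows "\<exists>h. bij_betw h A B \<and> h a = b"
proof -
  have "card (A - {a}) = card (B - {b})"
    using assms by simp
  then obtain h where h: "bij_betw h (A - {a}) (B - {b})"
    using assms finite_same_card_bij[of "A - {a}" "B - {b}"] by auto
  have "(h(a := b)) x = h x" if "x \<in> A - {a}" for x
    using that by simp
  then have "bij_betw (h(a := b)) (A - {a}) (B - {b})"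
    using h by (subst bij_betw_cong[of "A - {a}" "h(a := b)" h])
  moreover have "bij_betw (h(a := b)) {a} {b}"
    by (simp add: bij_betw_def)
  ultimately have "bij_betw (h(a := b)) ((A - {a}) \<union> {a}) ((B - {b}) \<union> {b})"
    by (rule bij_betw_combine) simp
  then show ?thesis
    using assms(4,5) by (intro exI[of _ "h(a := b)"]) (simp add: insert_absorb)
qed

text \<open>An edge has at most one end in an independent column, so identification loses no degree.\<close>

lemma column_degree:
  assumes R: "three_row_graph s R" and j: "j \<in> {1..s}"
  shows "degree (column_graph R) j = (\<Sum>v\<in>column j. degree R v)"
proof -
  have G: "finite_loopless R" and ind: "independent R (column j)"
    using R j by (auto simp: three_row_graph_def)
  have fin: "finite (edges R)" "finite (column j)"
    using G by (auto simp: finite_loopless_def column_def)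
  have "(\<Sum>v\<in>column j. degree R v) = (\<Sum>e\<in>edges R. card (ends R e \<inter> column j))"
    using sum_incidences[OF fin, of R] by (simp add: degree_def incident_edges_def)
  also have "\<dots> = (\<Sum>e\<in>edges R. if j \<in> snd ` ends R e then 1 else 0)"
  proof (rule sum.cong[OF refl])
    fix e assume e: "e \<in> edges R"
    then obtain u w where uw: "ends R e = {u, w}" "u \<noteq> w" "u \<in> verts R" "w \<in> verts R"
      using G by (auto simp: finite_loopless_def card_2_iff)
    have in_col: "v \<in> column j \<longleftrightarrow> snd v = j" if "v \<in> verts R" for v
      using R that by (cases v) (auto simp: three_row_graph_def column_def)
    have "\<not> (snd u = j \<and> snd w = j)"
    proof
      assume "snd u = j \<and> snd w = j"
      then have "ends R e \<subseteq> column j"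
        using uw in_col by simp
      then show False
        using ind e by (simp add: independent_def)
    qed
    moreover have "ends R e \<inter> column j = (if snd u = j then {u} else {}) \<union> (if snd w = j then {w} else {})"
      using in_col[OF uw(3)] in_col[OF uw(4)] unfolding uw(1) by auto
    ultimately show "card (ends R e \<inter> column j) = (if j \<in> snd ` ends R e then 1 else 0)"
      using uw(1) by auto
  qed
  also have "\<dots> = card {e \<in> edges R. j \<in> snd ` ends R e}"
    using fin by (simp add: sum.If_cases Int_def)
  finally show ?thesis
    by (simp add: column_graph_def identify_def degree_def incident_edges_def)
qed

theorem corollary21:
  fixes R :: "(nat \<times> nat, 'e) multigraph" and s p q :: nat
  assumes "three_row_graph s R"
    and "eulerian (column_graph R)"
    and "{p, q} \<subseteq> {1..s}"
    and "\<And>j. j \<in> {1..s} \<Longrightarrow> j \<notin> {p, q} \<Longrightarrow>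
      \<exists>v \<in> column j. \<exists>w \<in> column j. v \<noteq> w \<and> isolated R v \<and> isolated R w"
  shows "\<exists>f g. amiable_coloring s R f g"
proof -
  note R = assms(1)
  have G: "finite_loopless R" and verts: "verts R = {1..3} \<times> {1..s}"
    using R by (auto simp: three_row_graph_def)
  have col: "column j \<subseteq> verts R" if "j \<in> {1..s}" for j
    using that by (auto simp: verts column_def)
  have sum_col: "(\<Sum>v\<in>column j. h v) = h (1, j) + h (2, j) + h (3, j)" for h :: "nat \<times> nat \<Rightarrow> nat" and j
    by (simp add: column_def)
  have even_col: "even (\<Sum>v\<in>column j. degree R v)" if j: "j \<in> {1..s}" for j
  proof -
    have "(1, j) \<in> verts R"
      using j by (simp add: verts)
    then have "j \<in> verts (column_graph R)"
      by (force simp: column_graph_def identify_def)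
    then show ?thesis
      using assms(2) unfolding eulerian_def column_degree[OF R j, symmetric] by blast
  qed
  have active: "\<exists>a. \<forall>v \<in> column j. v \<noteq> a \<longrightarrow> incident_edges R v = {}"
    if j: "j \<in> {1..s}" "j \<notin> {p, q}" for j
  proof -
    obtain v w where vw: "v \<in> column j" "w \<in> column j" "v \<noteq> w"
        "incident_edges R v = {}" "incident_edges R w = {}"
      using assms(4)[OF j] by (auto simp: isolated_def)
    then have "card (column j - {v, w}) = 1"
      by (simp add: card_Diff_subset) (simp add: column_def)
    then obtain a where "column j - {v, w} = {a}"
      by (rule card_1_singletonE)
    then show ?thesis
      using vw(4,5) by blast
  qed
  \<comment> \<open>For \<open>p = q\<close> the second set must be empty to keep the two sets disjoint.\<close>
  define P where "P = column p"
  define Q where "Q = (if p = q then {} else column q)"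
  have PQ: "P \<subseteq> verts R" "Q \<subseteq> verts R" "P \<inter> Q = {}" "card P \<le> 3" "card Q \<le> 3"
    using col assms(3) by (auto simp: P_def Q_def column_def)
  have special: "column j = P \<or> column j = Q" if "j \<in> {p, q}" for j
    using that by (auto simp: P_def Q_def)
  have outside: "v \<in> P \<union> Q \<longleftrightarrow> snd v \<in> {p, q}" if "v \<in> verts R" for v
    using that by (cases v) (auto simp: P_def Q_def column_def verts)
  have in_col: "v \<in> column (snd v)" "snd v \<in> {1..s}" if "v \<in> verts R" for v
    using that by (cases v; auto simp: column_def verts)+
  have deg: "even (degree R v)" if v: "v \<in> verts R - (P \<union> Q)" for v
  proof -
    have j: "snd v \<in> {1..s}" "snd v \<notin> {p, q}"
      using v outside[of v] in_col[of v] by simp_all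
    then obtain a where a: "\<And>u. u \<in> column (snd v) \<Longrightarrow> u \<noteq> a \<Longrightarrow> incident_edges R u = {}"
      using active by blast
    show ?thesis
    proof (cases "v = a")
      case True
      have "(\<Sum>u\<in>column (snd v) - {v}. degree R u) = 0"
        using a True by (simp add: degree_def)
      then have "(\<Sum>u\<in>column (snd v). degree R u) = degree R v"
        using sum.remove[of "column (snd v)" v "degree R"] in_col[of v] v by (simp add: column_def)
      then show ?thesis
        using even_col[OF j(1)] by simp
    next
      case False
      then show ?thesis
        using a in_col[of v] v by (simp add: degree_def)
    qed
  qed
  have "even (\<Sum>v\<in>P. degree R v)"
    using even_col assms(3) by (simp add: P_def)
  from two_special_sets[OF G PQ deg this]
  obtain f g where comp: "compatible R f g" and inj: "inj_on f P" "inj_on f Q"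
    and bal: "\<And>v. v \<in> verts R - (P \<union> Q) \<Longrightarrow> balanced R g v"
      "\<And>c. c \<in> {1, 2, 3} \<Longrightarrow> even (\<Sum>v\<in>P. color_degree R g c v)"
      "\<And>c. c \<in> {1, 2, 3} \<Longrightarrow> even (\<Sum>v\<in>Q. color_degree R g c v)"
    by blast
  \<comment> \<open>Only the color of the non-isolated vertex of an ordinary column is constrained by the
     edges, so the other two vertices can be given the two remaining colors.\<close>
  have "\<exists>h. inj_on h (column j) \<and> h ` column j \<subseteq> {1, 2, 3} \<and>
      (\<forall>v \<in> column j. incident_edges R v \<noteq> {} \<longrightarrow> h v = f v)" if j: "j \<in> {1..s}" for j
  proof (cases "j \<in> {p, q}")
    case True
    then have "inj_on f (column j)"
      using special inj by metis
    moreover have "f ` column j \<subseteq> {1, 2, 3}"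
      using comp col[OF j] unfolding compatible_def by blast
    ultimately show ?thesis
      by blast
  next
    case False
    then obtain a where a: "\<And>v. v \<in> column j \<Longrightarrow> v \<noteq> a \<Longrightarrow> incident_edges R v = {}"
      using active[OF j] by blast
    show ?thesis
    proof (cases "a \<in> column j")
      case True
      then have "f a \<in> {1, 2, 3}"
        using comp col[OF j] unfolding compatible_def by blast
      moreover have "finite (column j)" "card (column j) = card {1, 2, 3 :: nat}"
        by (simp_all add: column_def)
      ultimately obtain h where h: "bij_betw h (column j) {1, 2, 3 :: nat}" "h a = f a"
        using bij_betw_prescribed_value[of "column j" "{1, 2, 3}" a "f a"] True by auto
      then show ?thesis
        using a unfolding bij_betw_def by (intro exI[of _ h]) auto
    next
      case False
      then have "\<forall>v \<in> column j. incident_edges R v = {}"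
        using a by blast
      then show ?thesis
        by (intro exI[of _ fst]) (auto simp: column_def)
    qed
  qed
  then obtain h where h: "\<And>j. j \<in> {1..s} \<Longrightarrow> inj_on (h j) (column j)"
      "\<And>j. j \<in> {1..s} \<Longrightarrow> h j ` column j \<subseteq> {1, 2, 3}"
      "\<And>j v. j \<in> {1..s} \<Longrightarrow> v \<in> column j \<Longrightarrow> incident_edges R v \<noteq> {} \<Longrightarrow> h j v = f v"
    by metis
  define f' where "f' = (\<lambda>v. h (snd v) v)"
  have f'_col: "f' v = h j v" if "v \<in> column j" for v j
    using that by (auto simp: f'_def column_def)
  have "amiable_coloring s R f' g"
    unfolding amiable_coloring_def
  proof (intro conjI ballI impI)
    fix v assume v: "v \<in> verts R"
    then show "f' v \<in> {1, 2, 3}"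
      using h(2) in_col unfolding f'_def by blast
    fix e assume e: "e \<in> incident_edges R v"
    then have "f' v = f v"
      using h(3) in_col[OF v] unfolding f'_def by blast
    moreover have "f v \<in> f ` ends R e" "g e \<notin> f ` ends R e"
      using comp e by (auto simp: compatible_def incident_edges_def)
    ultimately show "f' v \<noteq> g e"
      by metis
  next
    fix e assume "e \<in> edges R"
    then show "g e \<in> {1, 2, 3}"
      using comp by (simp add: compatible_def)
  next
    fix j v w assume "j \<in> {1..s}" "v \<in> column j" "w \<in> column j" "v \<noteq> w"
    then show "f' v \<noteq> f' w"
      using h(1) f'_col by (metis inj_onD)
  next
    fix c j :: nat assume c: "c \<in> {1, 2, 3}" and j: "j \<in> {1..s}"
    have "even (\<Sum>v\<in>column j. color_degree R g c v)"
    proof (cases "j \<in> {p, q}")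
      case True
      then show ?thesis
        using special bal(2,3)[OF c] by metis
    next
      case False
      have "even (color_degree R g c v)" if "v \<in> column j" for v
      proof -
        have "snd v = j"
          using that by (auto simp: column_def)
        then show ?thesis
          using bal(1)[of v] c False that col[OF j] outside[of v] unfolding balanced_def by blast
      qed
      then show ?thesis
        by (rule dvd_sum)
    qed
    then show "even (color_degree R g c (1, j) + color_degree R g c (2, j) + color_degree R g c (3, j))"
      by (simp only: sum_col)
  qed
  then show ?thesis
    by blast
qed

end
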